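(* Let $(T,Q)$ be a simple parameter pair, $t=T^2/Q-2\notin\{0,\pm1,\pm2\}$, $\Delta=T^2-4Q$, and $(\widehat T,\widehat Q)=(\Delta,-\Delta Q)$. For any sequence $\{z_n\}_{n\in\mathbb Z}=Z\in\mathcal R(t)$, the polar sequences $\{x_n\}_{n\in\mathbb Z}=X=\Phi^{-1}(Z)\in\mathcal R(T,Q)$ and $\{y_n\}_{n\in\mathbb Z}=CX\in\mathcal R(T,Q)$ are given, for all $k\in\mathbb Z$, by $$x_{2k}=TQ^{k-1}z_k,\qquad x_{2k-1}=Q^{k-1}(z_k+z_{k-1}),$$ $$y_{2k}=Q^k(z_{k+1}-z_{k-1}),\qquad y_{2k-1}=TQ^{k-1}(z_k-z_{k-1}).$$ Further, the sequences $\{\widehat x_n\}_{n\in\mathbb Z}$ and $\{\widehat y_n\}_{n\in\mathbb Z}$ given, for all $k\in\mathbb Z$, by $$\widehat x_{2k}=T^{-1}\Delta^kx_{2k},\qquad \widehat x_{2k-1}=T^{-1}\Delta^{k-1}y_{2k-1},$$ $$\widehat y_{2k}=\Delta^ky_{2k},\qquad \widehat y_{2k-1}=\Delta^kx_{2k-1},$$ are polar sequences in $\mathcal R(\widehat T,\widehat Q)$.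
   Context: For rational $T,Q$ with $Q\ne0$ let $D_{T,Q}=\begin{pmatrix}0&-Q\\1&T\end{pmatrix}$ and let $\mathcal R(T,Q)$ be the commutative ring of all $2\times2$ rational matrices commuting with $D_{T,Q}$. Its elements are the matrices $[x_0\ x_1]:=\begin{pmatrix}x_1-Tx_0&-Qx_0\\ x_0&x_1\end{pmatrix}$, $x_0,x_1\in\mathbb Q$; the element $[x_0\ x_1]$ is identified with the two-sided sequence $\{x_n\}_{n\in\mathbb Z}$ given by $x_{n+1}=Tx_n-Qx_{n-1}$. Write $\mathcal R(t)=\mathcal R(t,1)$. A parameter pair $(T,Q)$ of nonzero numbers is simple if $T,Q$ are integers and for every prime divisor $p$ of $T$, $Q$ is not divisible by $p^2$. In $\mathcal R(T,Q)$ put $C=C_{T,Q}=[2\ T]$. For a sequence $X\in\mathcal R(T,Q)$, the sequences $X$ and $CX$ are called polar; explicitly, if $CX=\{y_n\}$ then $y_n=x_{n+1}-Qx_{n-1}$ for all $n$. In the last assertion, "polar sequences in $\mathcal R(\widehat T,\widehat Q)$" means that both belong to $\mathcal R(\widehat T,\widehat Q)$ and $\{\widehat y_n\}=C_{\widehat T,\widehat Q}\{\widehat x_n\}$. For nonzero $T,Q$ and $t=T^2/Q-2$, $\Phi:\mathcal R(T,Q)\to\mathcal R(t)$ is the ring isomorphism $\Phi(X)=A^{-1}XA$ with $A=\begin{pmatrix}Q&-Q\\0&T\end{pmatrix}$. *)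

theory Defs
  imports "HOL-Analysis.Analysis" "HOL-Computational_Algebra.Primes"
begin

abbreviation mat22 :: "rat \<Rightarrow> rat \<Rightarrow> rat \<Rightarrow> rat \<Rightarrow> rat^2^2" where
  "mat22 a b c d \<equiv> vector [vector [a, b], vector [c, d]]"

definition D_mat :: "rat \<Rightarrow> rat \<Rightarrow> rat^2^2" where
  "D_mat T Q = mat22 0 (- Q) 1 T"

definition seq_ring :: "rat \<Rightarrow> rat \<Rightarrow> (rat^2^2) set" where
  "seq_ring T Q = {M. M ** D_mat T Q = D_mat T Q ** M}"

text \<open>The matrix written \<open>[x\<^sub>0 x\<^sub>1]\<close>.\<close>

definition bracket :: "rat \<Rightarrow> rat \<Rightarrow> rat \<Rightarrow> rat \<Rightarrow> rat^2^2" where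
  "bracket T Q x0 x1 = mat22 (x1 - T * x0) (- Q * x0) x0 x1"

definition rec_seqs :: "rat \<Rightarrow> rat \<Rightarrow> (int \<Rightarrow> rat) set" where
  "rec_seqs T Q = {x. \<forall>n. x (n + 1) = T * x n - Q * x (n - 1)}"

definition mat_of_seq :: "rat \<Rightarrow> rat \<Rightarrow> (int \<Rightarrow> rat) \<Rightarrow> rat^2^2" where
  "mat_of_seq T Q x = bracket T Q (x 0) (x 1)"

text \<open>
  For \<open>Q \<noteq> 0\<close>, \<^const>\<open>mat_of_seq\<close> is a bijection from \<open>rec_seqs T Q\<close> onto \<open>seq_ring T Q\<close>
  (\<open>bij_betw_mat_of_seq\<close> below). The following function is its inverse and reads off the
  two-sided sequence with which a matrix is identified.
\<close>

definition seq_of_mat :: "rat \<Rightarrow> rat \<Rightarrow> rat^2^2 \<Rightarrow> int \<Rightarrow> rat" where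
  "seq_of_mat T Q M = the_inv_into (rec_seqs T Q) (mat_of_seq T Q) M"

definition C_mat :: "rat \<Rightarrow> rat \<Rightarrow> rat^2^2" where
  "C_mat T Q = bracket T Q 2 T"

definition polar :: "rat \<Rightarrow> rat \<Rightarrow> (int \<Rightarrow> rat) \<Rightarrow> (int \<Rightarrow> rat) \<Rightarrow> bool" where
  "polar T Q x y \<longleftrightarrow> x \<in> rec_seqs T Q \<and> y \<in> rec_seqs T Q \<and>
     mat_of_seq T Q y = C_mat T Q ** mat_of_seq T Q x"

definition simple_pair :: "rat \<Rightarrow> rat \<Rightarrow> bool" where
  "simple_pair T Q \<longleftrightarrow> T \<noteq> 0 \<and> Q \<noteq> 0 \<and>
     (\<exists>a b :: int. T = of_int a \<and> Q = of_int b \<and>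
       (\<forall>p. prime p \<longrightarrow> p dvd a \<longrightarrow> \<not> p\<^sup>2 dvd b))"

definition A_mat :: "rat \<Rightarrow> rat \<Rightarrow> rat^2^2" where
  "A_mat T Q = mat22 Q (- Q) 0 T"

text \<open>
  For \<open>T, Q \<noteq> 0\<close> this maps \<open>seq_ring T Q\<close> bijectively onto \<open>seq_ring t 1\<close> with
  \<open>t = T\<^sup>2 / Q - 2\<close> (\<open>bij_betw_Phi\<close> below); outside \<open>seq_ring T Q\<close> its values are irrelevant.
\<close>

definition Phi :: "rat \<Rightarrow> rat \<Rightarrow> rat^2^2 \<Rightarrow> rat^2^2" where
  "Phi T Q X = matrix_inv (A_mat T Q) ** X ** A_mat T Q"

definition Phi_inv :: "rat \<Rightarrow> rat \<Rightarrow> rat^2^2 \<Rightarrow> rat^2^2" where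
  "Phi_inv T Q Z = the_inv_into (seq_ring T Q) (Phi T Q) Z"

lemma mat22_eta: "M = mat22 (M$1$1) (M$1$2) (M$2$1) (M$2$2)"
  by (simp add: vec_eq_iff forall_2)

lemma mat22_eq_iff: "mat22 a b c d = mat22 a' b' c' d' \<longleftrightarrow> a = a' \<and> b = b' \<and> c = c' \<and> d = d'"
  by (auto simp: vec_eq_iff forall_2)

lemma mat22_mult:
  "mat22 a b c d ** mat22 a' b' c' d' =
     mat22 (a*a' + b*c') (a*b' + b*d') (c*a' + d*c') (c*b' + d*d')"
  by (simp add: vec_eq_iff forall_2 matrix_matrix_mult_def sum_2)

lemma mat22_one: "mat 1 = mat22 1 0 0 1"
  by (simp add: vec_eq_iff forall_2 mat_def)

lemma bracket_in_seq_ring: "bracket T Q a b \<in> seq_ring T Q"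
  by (simp add: seq_ring_def bracket_def D_mat_def mat22_mult mat22_eq_iff algebra_simps)

lemma seq_ring_eq_bracket:
  assumes "M \<in> seq_ring T Q"
  shows "M = bracket T Q (M$2$1) (M$2$2)"
proof -
  obtain a b c d where M: "M = mat22 a b c d"
    using mat22_eta by blast
  have "b = - Q * c" "a = d - T * c"
    using assms unfolding M seq_ring_def D_mat_def mem_Collect_eq mat22_mult mat22_eq_iff
    by (simp_all add: algebra_simps)
  then show ?thesis
    by (simp add: M bracket_def)
qed

lemma rec_seqs_eqI:
  assumes "Q \<noteq> 0" "x \<in> rec_seqs T Q" "y \<in> rec_seqs T Q" "x 0 = y 0" "x 1 = y 1"
  shows "x = y"
proof
  fix n :: int
  have x: "x (n + 1) = T * x n - Q * x (n - 1)" and y: "y (n + 1) = T * y n - Q * y (n - 1)" for n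
    using assms by (simp_all add: rec_seqs_def)
  have "x n = y n \<and> x (n + 1) = y (n + 1)"
  proof (induction n rule: int_induct[where k = 0])
    case base
    then show ?case using assms by simp
  next
    case (step1 i)
    then show ?case using x[of "i + 1"] y[of "i + 1"] by simp
  next
    case (step2 i)
    then have "T * x i = T * y i" "x (i + 1) = y (i + 1)" by simp_all
    then have "Q * x (i - 1) = Q * y (i - 1)"
      using x[of i] y[of i] by linarith
    then have "x (i - 1) = y (i - 1)"
      using assms(1) by simp
    then show ?case using step2 by simp
  qed
  then show "x n = y n" by simp
qed

lemma ex_rec_seq:
  assumes "Q \<noteq> 0"
  shows "\<exists>x \<in> rec_seqs T Q. x 0 = a \<and> x 1 = b"
proof -
  define F where "F = (\<lambda>p :: rat \<times> rat. (snd p, T * snd p - Q * fst p))"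
  define G where "G = (\<lambda>p :: rat \<times> rat. ((T * fst p - snd p) / Q, fst p))"
  define u where "u n = (if n \<ge> 0 then (F ^^ nat n) (a, b) else (G ^^ nat (- n)) (a, b))" for n :: int
  have FG: "F (G p) = p" for p
    using assms by (simp add: F_def G_def)
  have u: "u (n + 1) = F (u n)" for n
  proof (cases "n \<ge> 0")
    case True
    then show ?thesis by (simp add: u_def nat_add_distrib)
  next
    case False
    then obtain m where m: "nat (- n) = Suc m" "n = - int (Suc m)"
      by (metis add.inverse_inverse int_nat_eq linorder_not_le neg_0_le_iff_le
          neg_less_0_iff_less nat_less_le nat_0_le not0_implies_Suc zero_less_nat_eq less_not_refl2 less_imp_le)
    then show ?thesis
      by (cases m) (auto simp: u_def FG nat_add_distrib)
  qed
  define x where "x n = fst (u n)" for n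
  have snd: "snd (u n) = x (n + 1)" for n
    by (simp add: x_def u F_def)
  have "x (n + 1) = T * x n - Q * x (n - 1)" for n
  proof -
    have "snd (u n) = T * snd (u (n - 1)) - Q * fst (u (n - 1))"
      using u[of "n - 1"] by (simp add: F_def)
    then show ?thesis
      using snd[of n] snd[of "n - 1"] by (simp add: x_def)
  qed
  then have "x \<in> rec_seqs T Q"
    by (simp add: rec_seqs_def)
  moreover have "x 0 = a" "x 1 = b"
    using snd[of 0] by (simp_all add: x_def u_def)
  ultimately show ?thesis by blast
qed

lemma bij_betw_mat_of_seq:
  assumes "Q \<noteq> 0"
  shows "bij_betw (mat_of_seq T Q) (rec_seqs T Q) (seq_ring T Q)"
  unfolding bij_betw_def
proof
  show "inj_on (mat_of_seq T Q) (rec_seqs T Q)"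
    by (rule inj_onI) (auto simp: mat_of_seq_def bracket_def mat22_eq_iff intro: rec_seqs_eqI[OF assms])
  have "M \<in> mat_of_seq T Q ` rec_seqs T Q" if M: "M \<in> seq_ring T Q" for M
  proof -
    obtain x where x: "x \<in> rec_seqs T Q" "x 0 = M$2$1" "x 1 = M$2$2"
      using ex_rec_seq[OF assms] by blast
    have "M = mat_of_seq T Q x"
      unfolding mat_of_seq_def x by (rule seq_ring_eq_bracket[OF M])
    then show ?thesis
      using x(1) by (rule image_eqI)
  qed
  then show "mat_of_seq T Q ` rec_seqs T Q = seq_ring T Q"
    by (auto simp: mat_of_seq_def bracket_in_seq_ring)
qed

lemma A_mat_inv:
  assumes "T \<noteq> 0" "Q \<noteq> 0"
  shows "matrix_inv (A_mat T Q) = mat22 (1 / Q) (1 / T) 0 (1 / T)" (is "_ = ?B")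
proof -
  have B: "A_mat T Q ** ?B = mat 1" "?B ** A_mat T Q = mat 1"
    using assms by (simp_all add: A_mat_def mat22_mult mat22_one mat22_eq_iff)
  then have "\<exists>B. A_mat T Q ** B = mat 1 \<and> B ** A_mat T Q = mat 1" by blast
  then have "matrix_inv (A_mat T Q) ** A_mat T Q = mat 1"
    unfolding matrix_inv_def by (rule someI2_ex) simp
  then have "(matrix_inv (A_mat T Q) ** A_mat T Q) ** ?B = ?B"
    by simp
  then show ?thesis
    by (simp only: matrix_mul_assoc[symmetric] B matrix_mul_rid)
qed

lemma bij_betw_Phi:
  assumes "T \<noteq> 0" "Q \<noteq> 0"
  shows "bij_betw (Phi T Q) (seq_ring T Q) (seq_ring (T\<^sup>2 / Q - 2) 1)"
proof (rule bij_betw_byWitness[where f' = "\<lambda>Z. A_mat T Q ** Z ** matrix_inv (A_mat T Q)"])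
  let ?A = "A_mat T Q" and ?B = "matrix_inv (A_mat T Q)"
  have AB: "?A ** ?B = mat 1" and BA: "?B ** ?A = mat 1"
    using assms unfolding A_mat_inv[OF assms] unfolding A_mat_def mat22_mult mat22_one mat22_eq_iff
    by simp_all
  have assoc: "U ** (V ** X ** U) ** V = (U ** V) ** X ** (U ** V)" for U V X :: "rat^2^2"
    by (simp only: matrix_mul_assoc)
  show "\<forall>X \<in> seq_ring T Q. ?A ** Phi T Q X ** ?B = X"
    by (simp only: Phi_def assoc AB matrix_mul_lid matrix_mul_rid) simp
  show "\<forall>Z \<in> seq_ring (T\<^sup>2 / Q - 2) 1. Phi T Q (?A ** Z ** ?B) = Z"
    by (simp only: Phi_def assoc BA matrix_mul_lid matrix_mul_rid) simp
  have Phi_bracket: "Phi T Q (bracket T Q a b) =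
      bracket (T\<^sup>2 / Q - 2) 1 (Q * a / T) (b - Q * a / T)" for a b
    unfolding Phi_def A_mat_inv[OF assms] unfolding A_mat_def bracket_def mat22_mult mat22_eq_iff
    using assms by (simp add: field_simps power2_eq_square)
  show "Phi T Q ` seq_ring T Q \<subseteq> seq_ring (T\<^sup>2 / Q - 2) 1"
  proof (rule image_subsetI)
    fix X assume "X \<in> seq_ring T Q"
    from seq_ring_eq_bracket[OF this] obtain a b where "X = bracket T Q a b" by blast
    then show "Phi T Q X \<in> seq_ring (T\<^sup>2 / Q - 2) 1"
      by (simp only: Phi_bracket bracket_in_seq_ring)
  qed
  have inv_bracket: "?A ** bracket (T\<^sup>2 / Q - 2) 1 a b ** ?B = bracket T Q (T * a / Q) (a + b)" for a b
    unfolding A_mat_inv[OF assms] unfolding A_mat_def bracket_def mat22_mult mat22_eq_iff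
    using assms by (simp add: field_simps power2_eq_square)
  show "(\<lambda>Z. ?A ** Z ** ?B) ` seq_ring (T\<^sup>2 / Q - 2) 1 \<subseteq> seq_ring T Q"
  proof (rule image_subsetI)
    fix Z assume "Z \<in> seq_ring (T\<^sup>2 / Q - 2) 1"
    from seq_ring_eq_bracket[OF this] obtain a b where "Z = bracket (T\<^sup>2 / Q - 2) 1 a b" by blast
    then show "?A ** Z ** ?B \<in> seq_ring T Q"
      by (simp only: inv_bracket bracket_in_seq_ring)
  qed
qed

end

theory Submission
  imports Defs
begin

text \<open>
  Multiplication by \<open>C\<close> is a difference operator on sequences: \<open>y = C x\<close> means
  \<open>y\<^sub>n = x\<^sub>n\<^sub>+\<^sub>1 - Q x\<^sub>n\<^sub>-\<^sub>1\<close> (\<open>polar_iff\<close>). A solution of the recurrence is determined by its values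
  at \<open>0\<close> and \<open>1\<close>, so the formulas for \<open>x\<close> hold because their right-hand sides, interleaved, form a
  solution of the recurrence (\<open>interleave_in_rec_seqs\<close>, which rests on \<open>T\<^sup>2 = (t + 2) Q\<close>) with the
  initial values that conjugation by \<open>A\<close> prescribes (\<open>Phi_inv_bracket\<close>). The formulas for \<open>y\<close>
  then follow by taking differences.

  The second assertion is a fact about any polar pair with \<open>T\<close>, \<open>Q\<close>, \<open>\<Delta>\<close> nonzero
  (\<open>polar_interchange\<close>). Since \<open>C\<^sup>2 = \<Delta>\<close>, the relation \<open>y\<^sub>n = x\<^sub>n\<^sub>+\<^sub>1 - Q x\<^sub>n\<^sub>-\<^sub>1\<close> comes with a
  companion \<open>\<Delta> x\<^sub>n = y\<^sub>n\<^sub>+\<^sub>1 - Q y\<^sub>n\<^sub>-\<^sub>1\<close>. Taking \<open>x\<close> at even and \<open>y\<close> at odd positions turns these two into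
  the two parity cases of a single recurrence, once powers of \<open>\<Delta>\<close> balance the factor \<open>\<Delta>\<close> that
  only one of them has.
\<close>

section \<open>Multiplication by \<open>C\<close> as a difference operator\<close>

lemma seq_of_mat:
  assumes "Q \<noteq> 0" "M \<in> seq_ring T Q"
  shows "seq_of_mat T Q M \<in> rec_seqs T Q" "mat_of_seq T Q (seq_of_mat T Q M) = M"
proof -
  note bij = bij_betw_mat_of_seq[OF assms(1), of T]
  show "seq_of_mat T Q M \<in> rec_seqs T Q"
    unfolding seq_of_mat_def
    using bij_betw_apply[OF bij_betw_the_inv_into[OF bij]] assms(2) by blast
  show "mat_of_seq T Q (seq_of_mat T Q M) = M"
    unfolding seq_of_mat_def
    using f_the_inv_into_f_bij_betw[OF bij] assms(2) by blast
qed

lemma bracket_eq_iff: "bracket T Q a b = bracket T Q a' b' \<longleftrightarrow> a = a' \<and> b = b'"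
  unfolding bracket_def mat22_eq_iff by auto

lemma C_mat_mult_bracket:
  "C_mat T Q ** bracket T Q a b = bracket T Q (2 * b - T * a) (T * b - 2 * Q * a)"
  unfolding C_mat_def bracket_def mat22_mult mat22_eq_iff by (simp add: algebra_simps)

lemma difference_in_rec_seqs:
  assumes "x \<in> rec_seqs T Q"
  shows "(\<lambda>n. x (n + 1) - Q * x (n - 1)) \<in> rec_seqs T Q"
proof -
  have x: "x (n + 1) = T * x n - Q * x (n - 1)" for n
    using assms by (simp add: rec_seqs_def)
  have "x (n + 1 + 1) - Q * x (n + 1 - 1) =
      T * (x (n + 1) - Q * x (n - 1)) - Q * (x (n - 1 + 1) - Q * x (n - 1 - 1))" for n
  proof -
    have "Q * x n = Q * (T * x (n - 1) - Q * x (n - 1 - 1))"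
      using x[of "n - 1"] by simp
    then show ?thesis
      using x[of "n + 1"] by (simp add: algebra_simps)
  qed
  then show ?thesis by (simp add: rec_seqs_def)
qed

text \<open>
  Both sides of \<open>y\<^sub>n = x\<^sub>n\<^sub>+\<^sub>1 - Q x\<^sub>n\<^sub>-\<^sub>1\<close> solve the recurrence, so the matrix identity, which only
  compares the positions \<open>0\<close> and \<open>1\<close>, already gives the relation at all \<open>n\<close>.
\<close>

lemma polar_iff:
  assumes "Q \<noteq> 0"
  shows "polar T Q x y \<longleftrightarrow> x \<in> rec_seqs T Q \<and> (\<forall>n. y n = x (n + 1) - Q * x (n - 1))"
proof (cases "x \<in> rec_seqs T Q")
  case True
  define d where "d = (\<lambda>n. x (n + 1) - Q * x (n - 1))"
  have d: "d \<in> rec_seqs T Q"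
    unfolding d_def by (rule difference_in_rec_seqs[OF True])
  have x: "x (n + 1) = T * x n - Q * x (n - 1)" for n
    using True by (simp add: rec_seqs_def)
  have d01: "d 0 = 2 * x 1 - T * x 0" "d 1 = T * x 1 - 2 * Q * x 0"
    using x[of 0] x[of 1] by (simp_all add: d_def)
  have "mat_of_seq T Q y = C_mat T Q ** mat_of_seq T Q x \<longleftrightarrow> y 0 = d 0 \<and> y 1 = d 1"
    unfolding mat_of_seq_def C_mat_mult_bracket bracket_eq_iff d01 ..
  then have "polar T Q x y \<longleftrightarrow> y = d"
    using True d rec_seqs_eqI[OF assms, of y T d] by (auto simp: polar_def)
  then show ?thesis
    using True by (simp add: d_def fun_eq_iff)
qed (simp add: polar_def)

lemma C_mat_mult_in_seq_ring:
  assumes "X \<in> seq_ring T Q"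
  shows "C_mat T Q ** X \<in> seq_ring T Q"
  by (subst seq_ring_eq_bracket[OF assms]) (simp only: C_mat_mult_bracket bracket_in_seq_ring)

lemma polar_seq_of_mat:
  assumes "Q \<noteq> 0" "X \<in> seq_ring T Q"
  shows "polar T Q (seq_of_mat T Q X) (seq_of_mat T Q (C_mat T Q ** X))"
  unfolding polar_def
  using seq_of_mat[OF assms] seq_of_mat[OF assms(1) C_mat_mult_in_seq_ring[OF assms(2)]] by simp

section \<open>The sequence of \<open>\<Phi>\<^sup>-\<^sup>1(Z)\<close>\<close>

lemma int_even_odd_cases:
  fixes P :: "int \<Rightarrow> bool"
  assumes "\<And>k. P (2 * k)" "\<And>k. P (2 * k - 1)"
  shows "P n"
proof (cases "even n")
  case True
  then show ?thesis using assms(1)[of "n div 2"] by simp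
next
  case False
  then obtain m where "n = 2 * m + 1" by (elim oddE)
  then have "n = 2 * (m + 1) - 1" by simp
  then show ?thesis by (simp only: assms(2))
qed

lemma Phi_bracket:
  assumes "T \<noteq> 0" "Q \<noteq> 0"
  shows "Phi T Q (bracket T Q a b) = bracket (T\<^sup>2 / Q - 2) 1 (Q * a / T) (b - Q * a / T)"
  unfolding Phi_def A_mat_inv[OF assms]
  unfolding A_mat_def bracket_def mat22_mult mat22_eq_iff
  using assms by (simp add: field_simps power2_eq_square)

lemma Phi_inv_bracket:
  assumes "T \<noteq> 0" "Q \<noteq> 0"
  shows "Phi_inv T Q (bracket (T\<^sup>2 / Q - 2) 1 a b) = bracket T Q (T * a / Q) (a + b)"
  unfolding Phi_inv_def
proof (rule the_inv_into_f_eq)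
  show "inj_on (Phi T Q) (seq_ring T Q)"
    using bij_betw_Phi[OF assms] by (rule bij_betw_imp_inj_on)
  show "Phi T Q (bracket T Q (T * a / Q) (a + b)) = bracket (T\<^sup>2 / Q - 2) 1 a b"
    using assms by (simp add: Phi_bracket)
qed (rule bracket_in_seq_ring)

lemma interleave_in_rec_seqs:
  assumes "Q \<noteq> 0" and z: "z \<in> rec_seqs (T\<^sup>2 / Q - 2) 1"
    and even: "\<And>k. w (2 * k) = T * Q powi (k - 1) * z k"
    and odd: "\<And>k. w (2 * k - 1) = Q powi (k - 1) * (z k + z (k - 1))"
  shows "w \<in> rec_seqs T Q"
proof -
  have Q: "Q powi k = Q * Q powi (k - 1)" for k
    using assms(1) power_int_add_1'[of Q "k - 1"] by simp
  have "w (n + 1) = T * w n - Q * w (n - 1)" for n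
  proof (induction n rule: int_even_odd_cases)
    case (1 k)
    have "z (k + 1) = (T\<^sup>2 / Q - 2) * z k - z (k - 1)"
      using z by (simp add: rec_seqs_def)
    then have zk: "Q * (z (k + 1) + z k) = T\<^sup>2 * z k - Q * (z k + z (k - 1))"
      using assms(1) by (simp add: field_simps)
    have "w (2 * k + 1) = Q powi (k - 1) * (Q * (z (k + 1) + z k))"
      using odd[of "k + 1"] by (simp add: Q[of k] add.commute mult.assoc)
    also have "\<dots> = T * w (2 * k) - Q * w (2 * k - 1)"
      unfolding zk even odd by (simp add: algebra_simps power2_eq_square)
    finally show ?case .
  next
    case (2 k)
    show ?case
      using even[of k] even[of "k - 1"] odd[of k] Q[of "k - 1"] by (simp add: algebra_simps)
  qed
  then show ?thesis by (simp add: rec_seqs_def)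
qed

text \<open>
  The initial value \<open>x\<^sub>0 = T z\<^sub>0 / Q\<close> is the even formula at \<open>k = 0\<close>; \<open>x\<^sub>1 = z\<^sub>0 + z\<^sub>1\<close> is the odd one at
  \<open>k = 1\<close>.
\<close>

lemma seq_of_Phi_inv:
  assumes "T \<noteq> 0" "Q \<noteq> 0" and t: "t = T\<^sup>2 / Q - 2" and Z: "Z \<in> seq_ring t 1"
  defines "z \<equiv> seq_of_mat t 1 Z" and "X \<equiv> Phi_inv T Q Z"
  shows "X \<in> seq_ring T Q"
    and "seq_of_mat T Q X (2 * k) = T * Q powi (k - 1) * z k"
    and "seq_of_mat T Q X (2 * k - 1) = Q powi (k - 1) * (z k + z (k - 1))"
proof -
  have z: "z \<in> rec_seqs t 1" and Zz: "Z = bracket t 1 (z 0) (z 1)"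
    using seq_of_mat[OF _ Z] by (simp_all add: z_def mat_of_seq_def)
  have X: "X = bracket T Q (T * z 0 / Q) (z 0 + z 1)"
    unfolding X_def Zz t by (rule Phi_inv_bracket[OF assms(1,2)])
  show XR: "X \<in> seq_ring T Q"
    unfolding X by (rule bracket_in_seq_ring)
  define w where "w n = (if even n then T * Q powi (n div 2 - 1) * z (n div 2)
      else Q powi ((n + 1) div 2 - 1) * (z ((n + 1) div 2) + z ((n + 1) div 2 - 1)))" for n :: int
  have w_even: "w (2 * k) = T * Q powi (k - 1) * z k" for k
    by (simp add: w_def)
  have w_odd: "w (2 * k - 1) = Q powi (k - 1) * (z k + z (k - 1))" for k
    by (simp add: w_def)
  have w: "w \<in> rec_seqs T Q"
    using assms(2) z[unfolded t] w_even w_odd by (rule interleave_in_rec_seqs)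
  have "bracket T Q (seq_of_mat T Q X 0) (seq_of_mat T Q X 1) = X"
    using seq_of_mat(2)[OF assms(2) XR] by (simp add: mat_of_seq_def)
  then have "seq_of_mat T Q X 0 = T * z 0 / Q" "seq_of_mat T Q X 1 = z 0 + z 1"
    by (simp_all add: X bracket_eq_iff)
  then have "seq_of_mat T Q X = w"
    using w_even[of 0] w_odd[of 1]
    by (intro rec_seqs_eqI[OF assms(2) seq_of_mat(1)[OF assms(2) XR] w])
      (simp_all add: power_int_minus divide_inverse add.commute)
  then show "seq_of_mat T Q X (2 * k) = T * Q powi (k - 1) * z k"
    and "seq_of_mat T Q X (2 * k - 1) = Q powi (k - 1) * (z k + z (k - 1))"
    by (simp_all add: w_even w_odd)
qed

section \<open>Interchanging polar sequences at odd positions\<close>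

text \<open>
  This is \<open>C\<^sup>2 = \<Delta>\<close>, read off at position \<open>n\<close>.
\<close>

lemma polar_twice:
  assumes "Q \<noteq> 0" "polar T Q x y"
  shows "y (n + 1) - Q * y (n - 1) = (T\<^sup>2 - 4 * Q) * x n"
proof -
  have x: "x (n + 1) = T * x n - Q * x (n - 1)" and y: "y n = x (n + 1) - Q * x (n - 1)" for n
    using assms by (auto simp: polar_iff rec_seqs_def)
  have "T * (T * x n) = T * x (n + 1) + Q * (T * x (n - 1))"
    unfolding x[of n] by (simp add: algebra_simps)
  also have "\<dots> = x (n + 1 + 1) + 2 * Q * x n + Q * (Q * x (n - 1 - 1))"
  proof -
    have "T * x (n + 1) = x (n + 1 + 1) + Q * x n" "T * x (n - 1) = x n + Q * x (n - 1 - 1)"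
      using x[of "n + 1"] x[of "n - 1"] by simp_all
    then show ?thesis by (simp add: distrib_left)
  qed
  finally show ?thesis
    unfolding y by (simp add: algebra_simps power2_eq_square)
qed

text \<open>
  Recurrences and difference operators change places. The recurrence of the new pair is the
  difference operator \<open>C\<close> of the old one, applied to \<open>x\<close> or to \<open>y\<close> according to parity. Because of
  the sign in \<open>- \<Delta> Q\<close>, the new difference operator is a sum, namely a rescaled left-hand side of
  \<open>x\<^sub>n\<^sub>+\<^sub>1 + Q x\<^sub>n\<^sub>-\<^sub>1 = T x\<^sub>n\<close> or of the same relation for \<open>y\<close>; the factor \<open>T\<^sup>-\<^sup>1\<close> cancels the \<open>T\<close>.
\<close>

lemma polar_interchange:
  fixes T Q \<Delta> :: rat
  assumes "T \<noteq> 0" "Q \<noteq> 0" "\<Delta> \<noteq> 0" and \<Delta>: "\<Delta> = T\<^sup>2 - 4 * Q"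
    and pol: "polar T Q x y"
    and x'_even: "\<And>k. x' (2 * k) = inverse T * \<Delta> powi k * x (2 * k)"
    and x'_odd: "\<And>k. x' (2 * k - 1) = inverse T * \<Delta> powi (k - 1) * y (2 * k - 1)"
    and y'_even: "\<And>k. y' (2 * k) = \<Delta> powi k * y (2 * k)"
    and y'_odd: "\<And>k. y' (2 * k - 1) = \<Delta> powi k * x (2 * k - 1)"
  shows "polar \<Delta> (- \<Delta> * Q) x' y'"
proof -
  have xrec: "T * x n = x (n + 1) + Q * x (n - 1)"
    and yrec: "T * y n = y (n + 1) + Q * y (n - 1)" for n
    using pol by (simp_all add: polar_def rec_seqs_def)
  have diff: "x (n + 1) = y n + Q * x (n - 1)" for n
    using pol by (simp add: polar_iff[OF assms(2)])
  have diff2: "y (n + 1) = \<Delta> * x n + Q * y (n - 1)" for n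
    using polar_twice[OF assms(2) pol, of n] unfolding \<Delta> by (simp add: algebra_simps)
  have pow: "\<Delta> powi k = \<Delta> * \<Delta> powi (k - 1)" for k
    using assms(3) power_int_add_1'[of \<Delta> "k - 1"] by simp
  have x'_next: "x' (2 * k + 1) = inverse T * \<Delta> powi k * y (2 * k + 1)" for k
    using x'_odd[of "k + 1"] by (simp add: add.commute)
  have x'_prev: "x' (2 * k - 2) = inverse T * \<Delta> powi (k - 1) * x (2 * k - 2)" for k
    using x'_even[of "k - 1"] by (simp add: algebra_simps)
  have idx: "2 * k - 1 + 1 = 2 * k" "2 * k - 1 - 1 = 2 * k - 2" for k :: int
    by simp_all
  have "x' (n + 1) = \<Delta> * x' n - (- \<Delta> * Q) * x' (n - 1)" for n
  proof (induction n rule: int_even_odd_cases)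
    case (1 k)
    show ?case
      unfolding x'_next x'_even x'_odd diff2[of "2 * k"] pow[of k]
      by (simp add: algebra_simps)
  next
    case (2 k)
    have "x (2 * k) = y (2 * k - 1) + Q * x (2 * k - 2)"
      using diff[of "2 * k - 1"] by simp
    then show ?case
      unfolding idx x'_even x'_odd x'_prev pow[of k] by (simp add: distrib_left)
  qed
  moreover have "y' n = x' (n + 1) - (- \<Delta> * Q) * x' (n - 1)" for n
  proof (induction n rule: int_even_odd_cases)
    case (1 k)
    have "y (2 * k) = inverse T * (y (2 * k + 1) + Q * y (2 * k - 1))"
      using assms(1) by (simp flip: yrec)
    then show ?case
      unfolding y'_even x'_odd x'_next pow[of k] by (simp add: distrib_left)
  next
    case (2 k)
    have "x (2 * k - 1) = inverse T * (x (2 * k) + Q * x (2 * k - 2))"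
      using assms(1) xrec[of "2 * k - 1"] by (simp add: field_simps)
    then show ?case
      unfolding idx y'_odd x'_even x'_prev pow[of k] by (simp add: distrib_left)
  qed
  ultimately show ?thesis
    using assms(2,3) by (subst polar_iff) (simp_all add: rec_seqs_def)
qed

theorem proposition8:
  fixes T Q t \<Delta> T' Q' :: rat
    and Z X Y :: "rat^2^2"
    and z x y x' y' :: "int \<Rightarrow> rat"
  assumes "simple_pair T Q"
    and "t = T\<^sup>2 / Q - 2"
    and "t \<notin> {0, 1, -1, 2, -2}"
    and "\<Delta> = T\<^sup>2 - 4 * Q"
    and "T' = \<Delta>" and "Q' = - \<Delta> * Q"
    and "Z \<in> seq_ring t 1" and "z = seq_of_mat t 1 Z"
    and "X = Phi_inv T Q Z" and "x = seq_of_mat T Q X"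
    and "Y = C_mat T Q ** X" and "y = seq_of_mat T Q Y"
    and "\<forall>k. x' (2 * k) = inverse T * \<Delta> powi k * x (2 * k)"
    and "\<forall>k. x' (2 * k - 1) = inverse T * \<Delta> powi (k - 1) * y (2 * k - 1)"
    and "\<forall>k. y' (2 * k) = \<Delta> powi k * y (2 * k)"
    and "\<forall>k. y' (2 * k - 1) = \<Delta> powi k * x (2 * k - 1)"
  shows "X \<in> seq_ring T Q \<and> Y \<in> seq_ring T Q \<and> polar T Q x y \<and>
    (\<forall>k. x (2 * k) = T * Q powi (k - 1) * z k \<and>
         x (2 * k - 1) = Q powi (k - 1) * (z k + z (k - 1)) \<and>
         y (2 * k) = Q powi k * (z (k + 1) - z (k - 1)) \<and>
         y (2 * k - 1) = T * Q powi (k - 1) * (z k - z (k - 1))) \<and>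
    polar T' Q' x' y'"
proof -
  note [simp] = assms(5,6)
  have T: "T \<noteq> 0" and Q: "Q \<noteq> 0"
    using assms(1) by (simp_all add: simple_pair_def)
  \<comment> \<open>\<open>\<Delta> = 0\<close> would mean \<open>t = 2\<close>.\<close>
  have \<Delta>: "\<Delta> \<noteq> 0"
    using assms(2-4) Q by auto
  note X = seq_of_Phi_inv[OF T Q assms(2,7), folded assms(8,9), folded assms(10)]
  have Y: "Y \<in> seq_ring T Q"
    unfolding assms(11) by (rule C_mat_mult_in_seq_ring[OF X(1)])
  have pol: "polar T Q x y"
    unfolding assms(10-12) by (rule polar_seq_of_mat[OF Q X(1)])
  then have y: "y n = x (n + 1) - Q * x (n - 1)" for n
    using Q by (simp add: polar_iff)
  have pow: "Q powi k = Q * Q powi (k - 1)" for k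
    using Q power_int_add_1'[of Q "k - 1"] by simp
  have y_even: "y (2 * k) = Q powi k * (z (k + 1) - z (k - 1))" for k
    using X(3)[of "k + 1"] X(3)[of k] by (simp add: y pow[of k] algebra_simps)
  have y_odd: "y (2 * k - 1) = T * Q powi (k - 1) * (z k - z (k - 1))" for k
    using X(2)[of k] X(2)[of "k - 1"] by (simp add: y pow[of "k - 1"] algebra_simps)
  have "polar \<Delta> (- \<Delta> * Q) x' y'"
    using assms(13-16) by (intro polar_interchange[OF T Q \<Delta> assms(4) pol]) simp_all
  then show ?thesis
    using X Y pol y_even y_odd by simp
qed

end
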